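(* Let $D_\infty(z)=\sum_{k=0}^\infty\frac{-1}{(z-2k)(z-2k-1)}$ on $\mathbb{C}\setminus\mathbb{Z}_{\ge0}$. Then $D_\infty$ has exactly one zero, counted with multiplicity, in the half-strip $\{z:1<\operatorname{Re}(z)<3/2,\ \operatorname{Im}(z)>0\}$, and (by $D_\infty(\bar z)=\overline{D_\infty(z)}$) exactly one in $\{z:1<\operatorname{Re}(z)<3/2,\ \operatorname{Im}(z)<0\}$. The corresponding conjugate pair $\rho_1,\bar\rho_1$ satisfies $\rho_1\approx1.34652+1.05516\,i$.
   Context: $D_\infty(z)=\sum_{j\ge0}(-1)^j/(z-j)$ with consecutive terms paired; its nonzero zeros coincide with those of $g^*(z)=2zD_\infty(z)=z\bigl(\psi(-z/2)-\psi((1-z)/2)\bigr)$. *)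

theory Defs
  imports "HOL-Complex_Analysis.Complex_Analysis"
begin

text \<open>
  The function is only meaningful on the complement of the set \<open>\<nat>\<close> of natural numbers, where the
  series converges absolutely; at a natural number one summand has a vanishing denominator and the
  value is an artefact of \<open>x / 0 = 0\<close>.
\<close>
definition D_inf :: "complex \<Rightarrow> complex" where
  "D_inf z = (\<Sum>k. - 1 / ((z - of_nat (2 * k)) * (z - of_nat (2 * k) - 1)))"

definition upper_half_strip :: "complex set" where
  "upper_half_strip = {z. 1 < Re z \<and> Re z < 3 / 2 \<and> Im z > 0}"

definition lower_half_strip :: "complex set" where
  "lower_half_strip = {z. 1 < Re z \<and> Re z < 3 / 2 \<and> Im z < 0}"

end

theory Submission
  imports Defs
begin

text \<open>
  Let \<open>\<beta>(w) = \<Sum>\<^sub>k 1 / ((w + 2k)(w + 2k + 1))\<close> be Nielsen's beta function. The reflection formula of the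
  digamma function gives \<open>D\<^sub>\<infinity>(z) = \<pi> / sin(\<pi>z) + \<beta>(z + 1)\<close>, so on the strip the zeros of \<open>D\<^sub>\<infinity>\<close> are those
  of \<open>\<Phi>(z) = sin(\<pi>z) / \<pi> + 1 / \<beta>(z + 1)\<close>. There \<open>\<beta>(z + 1)\<close> is close to \<open>1 / (2z + 1)\<close>, whereas \<open>sin(\<pi>z)\<close>
  grows exponentially with the imaginary part; comparing absolute values confines the zeros to a
  small convex rectangle. On that rectangle the derivative \<open>cos(\<pi>z)\<close> of the first summand of \<open>\<Phi>\<close> lies
  in the second quadrant and dominates the Lipschitz constant of \<open>1 / \<beta>(z + 1)\<close>, so
  \<open>|\<Phi>(z) - \<Phi>(z')| \<ge> c |z - z'|\<close> with \<open>c > 0\<close>. This gives uniqueness and simplicity, and by the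
  maximum principle also a zero in every disc about \<open>z\<^sub>0\<close> in the rectangle of radius more than
  \<open>2 |\<Phi>(z\<^sub>0)| / c\<close>; a numerical evaluation of \<open>D\<^sub>\<infinity>(z\<^sub>0)\<close> in rational arithmetic locates it.
\<close>

section \<open>Nielsen's beta function and the reflection formula\<close>

definition nielsen_beta :: "complex \<Rightarrow> complex" where
  "nielsen_beta w = (\<Sum>k. 1 / ((w + of_nat (2 * k)) * (w + of_nat (2 * k) + 1)))"

lemma of_nat_plus_nonzero:
  fixes w :: complex
  assumes "w \<notin> \<int>\<^sub>\<le>\<^sub>0"
  shows "w + of_nat n \<noteq> 0"
  using assms plus_of_nat_eq_0_imp by blast

lemma half_notin_nonpos_Ints:
  fixes w :: complex
  assumes "w \<notin> \<int>\<^sub>\<le>\<^sub>0"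
  shows "w / 2 \<notin> \<int>\<^sub>\<le>\<^sub>0" "(w + 1) / 2 \<notin> \<int>\<^sub>\<le>\<^sub>0"
proof -
  have "w + of_nat (2 * n) \<noteq> 0" "w + of_nat (2 * n + 1) \<noteq> 0" for n
    using of_nat_plus_nonzero[OF assms] by blast+
  moreover have "w + of_nat (2 * n) = 0 \<longleftrightarrow> w / 2 = - of_nat n"
    "w + of_nat (2 * n + 1) = 0 \<longleftrightarrow> (w + 1) / 2 = - of_nat n" for n
    by (auto simp: field_simps eq_neg_iff_add_eq_0 add_ac)
  ultimately have "w / 2 \<noteq> - of_nat n" "(w + 1) / 2 \<noteq> - of_nat n" for n
    by blast+
  then show "w / 2 \<notin> \<int>\<^sub>\<le>\<^sub>0" "(w + 1) / 2 \<notin> \<int>\<^sub>\<le>\<^sub>0"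
    by (auto elim!: nonpos_Ints_cases')
qed

text \<open>Partial fractions: \<open>1 / (u (u + 1)) = 1 / u - 1 / (u + 1)\<close> splits each term
  into one from the digamma series at \<open>w / 2\<close> and one from that at
  \<open>(w + 1) / 2\<close>. The terms \<open>1 / (n + 1)\<close>, which make both series converge
  separately, cancel in the difference.\<close>

lemma nielsen_beta_sums_Digamma:
  fixes w :: complex
  assumes "w \<notin> \<int>\<^sub>\<le>\<^sub>0"
  shows "(\<lambda>k. 1 / ((w + of_nat (2 * k)) * (w + of_nat (2 * k) + 1))) sums
           ((Digamma ((w + 1) / 2) - Digamma (w / 2)) / 2)"
proof -
  have S: "(\<lambda>n. inverse (of_nat (Suc n)) - inverse (v + of_nat n)) sums (Digamma v + euler_mascheroni)"
    if "v \<noteq> 0" for v :: complex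
    using summable_sums[OF summable_Digamma[OF that]] by (simp add: Digamma_def)
  have nz: "w / 2 \<noteq> 0" "(w + 1) / 2 \<noteq> 0"
    using half_notin_nonpos_Ints[OF assms] by auto
  have "(\<lambda>n. ((inverse (of_nat (Suc n)) - inverse ((w + 1) / 2 + of_nat n)) -
        (inverse (of_nat (Suc n)) - inverse (w / 2 + of_nat n))) / 2) sums
       ((Digamma ((w + 1) / 2) + euler_mascheroni - (Digamma (w / 2) + euler_mascheroni)) / 2)"
    by (intro sums_divide sums_diff S nz)
  also have "(\<lambda>n. ((inverse (of_nat (Suc n)) - inverse ((w + 1) / 2 + of_nat n)) -
        (inverse (of_nat (Suc n)) - inverse (w / 2 + of_nat n))) / 2) =
      (\<lambda>n. 1 / ((w + of_nat (2 * n)) * (w + of_nat (2 * n) + 1)))"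
  proof
    fix n
    have "w + of_nat (2 * n) \<noteq> 0" "w + of_nat (2 * n + 1) \<noteq> 0"
      using of_nat_plus_nonzero[OF assms] by blast+
    then have a: "w + 2 * of_nat n \<noteq> 0" "w + 2 * of_nat n + 1 \<noteq> 0"
      by (simp_all add: add_ac)
    have "((i - inverse ((u + 1) / 2)) - (i - inverse (u / 2))) / 2 = 1 / (u * (u + 1))"
      if "u \<noteq> 0" "u + 1 \<noteq> 0" for u i :: complex
    proof -
      have "((i - inverse (v / 2)) - (i - inverse (u / 2))) / 2 = 1 / u - 1 / v" for v
        by (simp add: inverse_eq_divide diff_divide_distrib)
      also have "1 / u - 1 / (u + 1) = 1 / (u * (u + 1))"
        using that by (simp add: divide_simps)
      finally show ?thesis .
    qed
    from this[OF a] show "((inverse (of_nat (Suc n)) - inverse ((w + 1) / 2 + of_nat n)) -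
        (inverse (of_nat (Suc n)) - inverse (w / 2 + of_nat n))) / 2 =
      1 / ((w + of_nat (2 * n)) * (w + of_nat (2 * n) + 1))"
      by (simp add: add_divide_distrib add_ac)
  qed
  finally show ?thesis by simp
qed

lemma nielsen_beta_Digamma:
  assumes "w \<notin> \<int>\<^sub>\<le>\<^sub>0"
  shows "nielsen_beta w = (Digamma ((w + 1) / 2) - Digamma (w / 2)) / 2"
  unfolding nielsen_beta_def by (rule sums_unique[OF nielsen_beta_sums_Digamma[OF assms], symmetric])

lemma nielsen_beta_sums:
  assumes "w \<notin> \<int>\<^sub>\<le>\<^sub>0"
  shows "(\<lambda>k. 1 / ((w + of_nat (2 * k)) * (w + of_nat (2 * k) + 1))) sums nielsen_beta w"
  using nielsen_beta_sums_Digamma[OF assms] by (simp only: nielsen_beta_Digamma[OF assms])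

lemma analytic_on_nielsen_beta: "A \<inter> \<int>\<^sub>\<le>\<^sub>0 = {} \<Longrightarrow> nielsen_beta analytic_on A"
proof (rule analytic_on_subset)
  have "open (- \<int>\<^sub>\<le>\<^sub>0 :: complex set)"
    by (simp add: open_Compl)
  moreover have "(\<lambda>w. (Digamma ((w + 1) / 2) - Digamma (w / 2)) / 2) analytic_on (- \<int>\<^sub>\<le>\<^sub>0 :: complex set)"
    by (intro analytic_intros ballI half_notin_nonpos_Ints) auto
  ultimately show "nielsen_beta analytic_on (- \<int>\<^sub>\<le>\<^sub>0)"
    by (subst analytic_on_open, simp, subst holomorphic_cong[OF refl nielsen_beta_Digamma])
       (auto simp: analytic_on_open)
qed auto

text \<open>Changing the sign of both factors of a denominator replaces \<open>z\<close> by
  \<open>-z\<close>; the minus sign is the numerator of the terms of \<open>D_inf\<close>.\<close>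

lemma D_inf_eq_nielsen_beta:
  assumes "z \<notin> \<nat>"
  shows "D_inf z = - nielsen_beta (- z)"
proof -
  have "- 1 / ((z - of_nat (2 * k)) * (z - of_nat (2 * k) - 1)) =
        - (1 / ((- z + of_nat (2 * k)) * (- z + of_nat (2 * k) + 1)))" for k
    by (metis (no_types, opaque_lifting) add_uminus_conv_diff minus_add_distrib minus_diff_eq
          minus_divide_left minus_mult_minus uminus_add_conv_diff)
  moreover have "(\<lambda>k. - (1 / ((- z + of_nat (2 * k)) * (- z + of_nat (2 * k) + 1)))) sums - nielsen_beta (- z)"
    by (intro sums_minus nielsen_beta_sums) (use assms in \<open>simp add: uminus_in_nonpos_Ints_iff\<close>)
  ultimately show ?thesis
    unfolding D_inf_def by (simp add: sums_iff)
qed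

lemma D_inf_cnj:
  assumes "z \<notin> \<nat>"
  shows "D_inf (cnj z) = cnj (D_inf z)"
proof -
  have z: "- z \<notin> \<int>\<^sub>\<le>\<^sub>0" using assms by (simp add: uminus_in_nonpos_Ints_iff)
  have c: "cnj z \<notin> \<nat>"
    using assms by (metis Nats_cases of_nat_in_Nats complex_cnj_cnj complex_cnj_of_nat)
  have "(\<lambda>k. 1 / ((- cnj z + of_nat (2 * k)) * (- cnj z + of_nat (2 * k) + 1))) sums cnj (nielsen_beta (- z))"
    using iffD2[OF sums_cnj nielsen_beta_sums[OF z]] by simp
  then have "nielsen_beta (- cnj z) = cnj (nielsen_beta (- z))"
    by (subst nielsen_beta_def) (rule sums_unique[symmetric])
  then show ?thesis using assms c by (simp add: D_inf_eq_nielsen_beta)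
qed

text \<open>Derivative of Euler's reflection formula
  \<open>Gamma z * Gamma (1 - z) = pi / sin (pi z)\<close>, with the common factor
  cancelled.\<close>

lemma Digamma_reflection:
  fixes z :: complex
  assumes "z \<notin> \<int>"
  shows "Digamma (1 - z) - Digamma z = of_real pi * cot (of_real pi * z)"
proof -
  have z: "z \<notin> \<int>\<^sub>\<le>\<^sub>0" "1 - z \<notin> \<int>\<^sub>\<le>\<^sub>0"
    using assms by (auto dest: nonpos_Ints_Int)
  have s: "sin (of_real pi * z) \<noteq> 0"
    using assms by (auto simp: sin_eq_0 mult.commute)
  have "((\<lambda>z. Gamma z * Gamma (1 - z)) has_field_derivative
          (Gamma z * Gamma (1 - z) * (Digamma z - Digamma (1 - z)))) (at z)"
    using z by (auto intro!: derivative_eq_intros simp: algebra_simps)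
  moreover have "((\<lambda>z. Gamma z * Gamma (1 - z)) has_field_derivative
          (- of_real pi * (of_real pi * cos (of_real pi * z)) / (sin (of_real pi * z))\<^sup>2)) (at z)"
    unfolding Gamma_reflection_complex using s
    by (auto intro!: derivative_eq_intros simp: power2_eq_square)
  ultimately have "of_real pi / sin (of_real pi * z) * (Digamma z - Digamma (1 - z)) =
       - of_real pi * (of_real pi * cos (of_real pi * z)) / (sin (of_real pi * z))\<^sup>2"
    unfolding Gamma_reflection_complex[symmetric] by (rule DERIV_unique)
  then have "(of_real pi / sin (of_real pi * z)) * (Digamma z - Digamma (1 - z)) =
      (of_real pi / sin (of_real pi * z)) * (- (of_real pi * cot (of_real pi * z)))"
    by (simp add: cot_def power2_eq_square)
  then have "Digamma z - Digamma (1 - z) = - (of_real pi * cot (of_real pi * z))"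
    using s by (simp only: mult_cancel_left) auto
  then show ?thesis by (metis minus_diff_eq minus_minus)
qed

text \<open>Reflection at \<open>(z + 1) / 2\<close> and \<open>1 + z / 2\<close> turns the digamma
  arguments \<open>(1 - z) / 2\<close> and \<open>- z / 2\<close> into ones with positive real part
  on the strip. With \<open>a = pi z / 2\<close> the two cotangents combine to
  \<open>cot a + tan a = 2 / sin (2 a)\<close>, the only term with exponential behaviour.\<close>

lemma D_inf_reflection:
  assumes "z \<notin> \<int>"
  shows "D_inf z = of_real pi / sin (of_real pi * z) + nielsen_beta (z + 1)"
proof -
  have n: "z \<notin> \<nat>" "- z \<notin> \<int>\<^sub>\<le>\<^sub>0" "z + 1 \<notin> \<int>\<^sub>\<le>\<^sub>0"
    using assms Nats_subset_Ints nonpos_Ints_subset_Ints minus_in_Ints_iff[of z]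
    by (auto dest!: nonpos_Ints_Int)
  have i: "(z + 1) / 2 \<notin> \<int>" "1 + z / 2 \<notin> \<int>"
  proof -
    have "z = 2 * ((z + 1) / 2) - 1" "z = 2 * (1 + z / 2) - 2" by (simp_all add: field_simps)
    then show "(z + 1) / 2 \<notin> \<int>" "1 + z / 2 \<notin> \<int>"
      using assms by (metis Ints_1 Ints_diff Ints_mult Ints_numeral)+
  qed
  define a where "a = of_real pi * z / 2"
  have s: "sin (of_real pi * z) \<noteq> 0"
    using assms by (auto simp: sin_eq_0 mult.commute)
  have dbl: "sin (of_real pi * z) = 2 * sin a * cos a"
    using sin_double[of a] by (simp add: a_def)
  with s have sc: "sin a \<noteq> 0" "cos a \<noteq> 0" by auto
  have c1: "cot (of_real pi * ((z + 1) / 2)) = - sin a / cos a"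
    unfolding cot_def a_def
    by (simp add: algebra_simps add_divide_distrib sin_add cos_add flip: sin_of_real cos_of_real)
  have c2: "cot (of_real pi * (1 + z / 2)) = cos a / sin a"
    unfolding cot_def a_def
    by (simp add: algebra_simps add_divide_distrib sin_add cos_add)
  have r1: "Digamma ((1 - z) / 2) = Digamma ((z + 1) / 2) - of_real pi * sin a / cos a"
    using Digamma_reflection[OF i(1)] unfolding c1 by (simp add: field_simps)
  have r2: "Digamma (- z / 2) = Digamma (1 + z / 2) + of_real pi * cos a / sin a"
    using Digamma_reflection[OF i(2)] unfolding c2 by (simp add: field_simps)
  have "D_inf z = (Digamma (- z / 2) - Digamma ((1 - z) / 2)) / 2"
    unfolding D_inf_eq_nielsen_beta[OF n(1)] nielsen_beta_Digamma[OF n(2)] by (simp add: field_simps)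
  also have "\<dots> = of_real pi * (cos a / sin a + sin a / cos a) / 2
      + (Digamma (1 + z / 2) - Digamma ((z + 1) / 2)) / 2"
    unfolding r1 r2 by (simp add: field_simps)
  also have "cos a / sin a + sin a / cos a = 1 / (sin a * cos a)"
    using sc by (simp add: field_simps)
  also have "of_real pi * (1 / (sin a * cos a)) / 2 = of_real pi / sin (of_real pi * z)"
    by (simp add: dbl)
  also have "(Digamma (1 + z / 2) - Digamma ((z + 1) / 2)) / 2 = nielsen_beta (z + 1)"
    unfolding nielsen_beta_Digamma[OF n(3)] by (simp add: add_divide_distrib add.commute)
  finally show ?thesis .
qed

section \<open>Bounds for the beta function\<close>

text \<open>All numerical bounds for the beta function below come from this: an explicit
  \<open>C\<close> whose differences dominate the terms bounds the whole series by
  \<open>C 0\<close>.\<close>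

lemma norm_sums_le_telescope:
  fixes f :: "nat \<Rightarrow> 'a::real_normed_vector" and C :: "nat \<Rightarrow> real"
  assumes "f sums F" and le: "\<And>k. norm (f k) \<le> C k - C (Suc k)" and nonneg: "\<And>k. 0 \<le> C k"
  shows "norm F \<le> C 0"
proof (rule Lim_bounded)
  show "(\<lambda>n. norm (\<Sum>k<n. f k)) \<longlonglongrightarrow> norm F"
    using assms(1) unfolding sums_def by (rule tendsto_norm)
  show "\<forall>n\<ge>0. norm (\<Sum>k<n. f k) \<le> C 0"
  proof (intro allI impI)
    fix n
    have "norm (\<Sum>k<n. f k) \<le> (\<Sum>k<n. C k - C (Suc k))"
      by (intro sum_norm_le le)
    also have "\<dots> = C 0 - C n"
      by (rule sum_lessThan_telescope')
    finally show "norm (\<Sum>k<n. f k) \<le> C 0"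
      using nonneg[of n] by linarith
  qed
qed

lemma notin_nonpos_Ints_if_Re_pos: "0 < Re w \<Longrightarrow> w \<notin> \<int>\<^sub>\<le>\<^sub>0"
  by (auto elim!: nonpos_Ints_cases')

lemma le_norm_if_le_Re: "r \<le> Re u \<Longrightarrow> r \<le> norm u"
  using complex_Re_le_cmod order_trans by blast

lemma norm_nielsen_beta_le:
  assumes "2 \<le> Re w"
  shows "norm (nielsen_beta w) \<le> 1 / 3"
proof -
  define C where "C k = 1 / (4 * real k + 3)" for k
  have "norm (nielsen_beta w) \<le> C 0"
  proof (rule norm_sums_le_telescope[OF nielsen_beta_sums[OF notin_nonpos_Ints_if_Re_pos]])
    fix k
    let ?u = "w + of_nat (2 * k)"
    have "(2 * real k + 2) * (2 * real k + 3) \<le> norm (?u * (?u + 1))"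
      unfolding norm_mult using assms by (intro mult_mono le_norm_if_le_Re) auto
    moreover have "0 < (2 * real k + 2) * (2 * real k + 3)" by (intro mult_pos_pos) linarith+
    ultimately have "norm (1 / (?u * (?u + 1))) \<le> 1 / ((2 * real k + 2) * (2 * real k + 3))"
      unfolding norm_divide norm_one by (intro frac_le) (assumption | simp)+
    \<comment> \<open>With \<open>s = 4k + 5\<close> the left side is \<open>4 / (s^2 - 1)\<close>
      and the right side is the telescoping \<open>4 / (s^2 - 4)\<close>.\<close>
    also have "\<dots> \<le> 4 / ((4 * real k + 3) * (4 * real k + 7))"
    proof -
      have "4 / (4 * ((2 * real k + 2) * (2 * real k + 3))) \<le> 4 / ((4 * real k + 3) * (4 * real k + 7))"
        by (intro divide_left_mono mult_pos_pos) (auto simp: algebra_simps)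
      then show ?thesis by simp
    qed
    also have "\<dots> = C k - C (Suc k)"
      by (simp add: C_def divide_simps)
    finally show "norm (1 / (?u * (?u + 1))) \<le> C k - C (Suc k)" .
  qed (use assms in \<open>auto simp: C_def\<close>)
  then show ?thesis by (simp add: C_def)
qed

text \<open>A Lipschitz bound read off the series: a difference of two terms has the factor
  \<open>v - w\<close>, and the cofactor is at most its value at \<open>w = v = 2\<close>. The
  majorant is chosen so that \<open>C 0\<close> is \<open>2 / (3^2 + 1) = 1 / 5\<close> times the
  distance.\<close>

lemma norm_nielsen_beta_diff_le:
  assumes "2 \<le> Re w" "2 \<le> Re v"
  shows "norm (nielsen_beta w - nielsen_beta v) \<le> norm (w - v) / 5"
proof -
  define C where "C k = norm (w - v) * (2 / ((4 * real k + 3)\<^sup>2 + 1))" for k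
  have "norm (nielsen_beta w - nielsen_beta v) \<le> C 0"
  proof (rule norm_sums_le_telescope[OF sums_diff[OF nielsen_beta_sums nielsen_beta_sums]])
    fix k
    let ?u = "w + of_nat (2 * k)" and ?v = "v + of_nat (2 * k)"
    \<comment> \<open>The midpoint of \<open>4k + 3\<close> and \<open>4k + 7\<close>, where
      \<open>C\<close> is evaluated at \<open>k\<close> and \<open>Suc k\<close>; all expressions
      become even or odd in \<open>s\<close>.\<close>
    define s where "s = 4 * real k + 5"
    have s: "s \<ge> 5" by (simp add: s_def)
    define a b where "a = 2 * real k + 2" and "b = 2 * real k + 3"
    have ab: "a > 0" "b > 0" by (simp_all add: a_def b_def)
    have n: "a \<le> norm ?u" "a \<le> norm ?v" "b \<le> norm (?u + 1)" "b \<le> norm (?v + 1)"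
      using assms by (auto intro!: le_norm_if_le_Re simp: a_def b_def)
    have nz: "?u \<noteq> 0" "?v \<noteq> 0" "?u + 1 \<noteq> 0" "?v + 1 \<noteq> 0"
      using n ab by auto
    have "1 / (p * (p + 1)) - 1 / (q * (q + 1)) =
        (q - p) * (1 / ((p + 1) * q * (q + 1)) + 1 / (p * (p + 1) * q))"
      if "p \<noteq> 0" "q \<noteq> 0" "p + 1 \<noteq> 0" "q + 1 \<noteq> 0" for p q :: complex
      using that by (simp add: divide_simps) (simp add: algebra_simps)
    note identity = this[OF nz]
    have "1 / (b * a * b) + 1 / (a * b * a) = 16 * s / (s\<^sup>2 - 1)\<^sup>2"
    proof -
      have "1 / (b * a * b) + 1 / (a * b * a) = (a + b) / (a * b)\<^sup>2"
        using ab by (simp add: field_simps power2_eq_square)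
      moreover have "a + b = s" by (simp add: a_def b_def s_def)
      moreover have "a * b = (s\<^sup>2 - 1) / 4" by (simp add: a_def b_def s_def power2_eq_square algebra_simps)
      ultimately have "1 / (b * a * b) + 1 / (a * b * a) = s / ((s\<^sup>2 - 1) / 4)\<^sup>2" by (simp only:)
      then show ?thesis by (simp add: power_divide)
    qed
    also have "\<dots> \<le> 16 * s / (s ^ 4 - 6 * s\<^sup>2 + 25)"
    proof (intro divide_left_mono mult_pos_pos)
      have "5\<^sup>2 \<le> s\<^sup>2" using s by (intro power_mono) auto
      then have q: "25 \<le> s\<^sup>2" by simp
      then show "s ^ 4 - 6 * s\<^sup>2 + 25 \<le> (s\<^sup>2 - 1)\<^sup>2"
        by (simp add: power2_diff flip: power_mult)
      have "s ^ 4 - 6 * s\<^sup>2 + 25 = (s\<^sup>2 - 3)\<^sup>2 + 16" by (simp add: power2_diff flip: power_mult)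
      then show "0 < s ^ 4 - 6 * s\<^sup>2 + 25"
        by (metis add_nonneg_pos zero_le_power2 zero_less_numeral)
      show "0 < (s\<^sup>2 - 1)\<^sup>2" using q by simp
    qed (use s in auto)
    also have "\<dots> = 2 / ((s - 2)\<^sup>2 + 1) - 2 / ((s + 2)\<^sup>2 + 1)"
    proof -
      have p: "(s - 2)\<^sup>2 + 1 > 0" "(s + 2)\<^sup>2 + 1 > 0" by (auto intro: add_nonneg_pos)
      have "2 / ((s - 2)\<^sup>2 + 1) - 2 / ((s + 2)\<^sup>2 + 1) =
         (2 * ((s + 2)\<^sup>2 + 1) - 2 * ((s - 2)\<^sup>2 + 1)) / (((s - 2)\<^sup>2 + 1) * ((s + 2)\<^sup>2 + 1))"
        using p by (intro diff_frac_eq) auto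
      also have "\<dots> = 16 * s / (s ^ 4 - 6 * s\<^sup>2 + 25)"
        by (intro arg_cong2[where f = "(/)"]) (simp_all add: power2_eq_square power4_eq_xxxx algebra_simps)
      finally show ?thesis ..
    qed
    finally have "1 / (b * a * b) + 1 / (a * b * a) \<le> 2 / ((s - 2)\<^sup>2 + 1) - 2 / ((s + 2)\<^sup>2 + 1)" .
    from identity have "norm (1 / (?u * (?u + 1)) - 1 / (?v * (?v + 1))) =
        norm (w - v) * norm (1 / ((?u + 1) * ?v * (?v + 1)) + 1 / (?u * (?u + 1) * ?v))"
      by (simp add: norm_mult norm_minus_commute)
    also have "\<dots> \<le> norm (w - v) * (1 / (b * a * b) + 1 / (a * b * a))"
      using n ab nz
      by (intro mult_left_mono order_trans[OF norm_triangle_ineq] add_mono)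
         (auto simp: norm_divide norm_mult intro!: divide_left_mono mult_mono mult_pos_pos)
    also have "\<dots> \<le> norm (w - v) * (2 / ((s - 2)\<^sup>2 + 1) - 2 / ((s + 2)\<^sup>2 + 1))"
      by (intro mult_left_mono) (fact, simp)
    finally show "norm (1 / (?u * (?u + 1)) - 1 / (?v * (?v + 1))) \<le> C k - C (Suc k)"
      by (simp add: C_def s_def right_diff_distrib add_ac)
  qed (use assms in \<open>auto simp: C_def intro!: notin_nonpos_Ints_if_Re_pos\<close>)
  then show ?thesis by (simp add: C_def)
qed

section \<open>Asymptotic expansion of the beta function in powers of
  \<open>1 / (2w - 1)\<close>\<close>

lemma sums_inverse_arith_progression:
  fixes x :: complex
  shows "(\<lambda>k. 1 / (x + of_nat (4 * k)) - 1 / (x + of_nat (4 * k) + 4)) sums (1 / x)"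
proof -
  have "(\<lambda>k. inverse (x + of_nat (4 * k))) \<longlonglongrightarrow> 0"
    by (intro filterlim_compose[OF tendsto_inverse_0] tendsto_add_filterlim_at_infinity[OF tendsto_const]
         filterlim_compose[OF tendsto_of_nat] filterlim_subseq) (auto simp: strict_mono_def)
  from telescope_sums'[OF this] show ?thesis
    by (simp add: inverse_eq_divide add_ac)
qed

text \<open>In the variable \<open>x\<close> consecutive terms are spaced by 4, as in the
  telescoping series for \<open>1 / x\<close> and \<open>1 / x^3\<close>, so the expansion can be
  checked term by term.\<close>

lemma nielsen_beta_sums_shifted:
  assumes "w \<notin> \<int>\<^sub>\<le>\<^sub>0" and "x = 2 * w - 1"
  shows "(\<lambda>k. 4 / ((x + of_nat (4 * k) + 1) * (x + of_nat (4 * k) + 3))) sums nielsen_beta w"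
proof -
  have "4 / ((x + of_nat (4 * k) + 1) * (x + of_nat (4 * k) + 3)) =
     1 / ((w + of_nat (2 * k)) * (w + of_nat (2 * k) + 1))" for k
  proof -
    have "x + of_nat (4 * k) + 1 = 2 * (w + of_nat (2 * k))" "x + of_nat (4 * k) + 3 = 2 * (w + of_nat (2 * k) + 1)"
      by (simp_all add: assms(2))
    moreover have "4 / ((2 * a) * (2 * b)) = 1 / (a * b)" for a b :: complex by simp
    ultimately show ?thesis by (simp only:)
  qed
  then show ?thesis using nielsen_beta_sums[OF assms(1)] by (simp only:)
qed

text \<open>The variable \<open>x = 2w - 1\<close> is chosen because the asymptotic expansion \<open>1 / x - 1 / x\<^sup>3 + \<dots>\<close> of \<open>\<beta>\<close>
  contains only odd powers of it.\<close>

lemma nielsen_beta_first_order: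
  assumes "2 \<le> Re w"
  shows "norm ((2 * w - 1) * nielsen_beta w - 1) \<le> 1 / 10"
proof -
  define x where "x = 2 * w - 1"
  have x: "3 \<le> Re x" using assms by (simp add: x_def)
  then have x0: "x \<noteq> 0" by auto
  \<comment> \<open>The terms are about \<open>12 / t^3\<close> with \<open>t = 4k + 3\<close>,
    which in steps of 4 sums to about \<open>(3 / 2) / t^2\<close>; the 6 makes \<open>C 0\<close>
    equal to \<open>1 / 10\<close>.\<close>
  define C where "C k = (3 / 2) / ((4 * real k + 3)\<^sup>2 + 6)" for k
  have w: "w \<notin> \<int>\<^sub>\<le>\<^sub>0" using assms by (intro notin_nonpos_Ints_if_Re_pos) auto
  have "norm (x * (1 / x - nielsen_beta w)) \<le> C 0"
  proof (rule norm_sums_le_telescope[OF sums_mult[OF sums_diff[OF sums_inverse_arith_progression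
           nielsen_beta_sums_shifted[OF w x_def]]]])
    fix k
    define y where "y = x + of_nat (4 * k)"
    define t where "t = 4 * real k + 3"
    have t: "3 \<le> t" by (simp add: t_def)
    have n: "t \<le> norm y" "t + 1 \<le> norm (y + 1)" "t + 3 \<le> norm (y + 3)" "t + 4 \<le> norm (y + 4)"
      using x by (auto intro!: le_norm_if_le_Re simp: t_def y_def)
    have nz: "y \<noteq> 0" "y + 1 \<noteq> 0" "y + 3 \<noteq> 0" "y + 4 \<noteq> 0"
      using n t by auto
    \<comment> \<open>Since \<open>Re x\<close> is positive, moving right increases the norm. The
      weight \<open>x\<close> is thus absorbed by \<open>y\<close>, and the bound is uniform in the
      imaginary part.\<close>
    have "norm x \<le> norm y"
      unfolding cmod_def y_def using x by (auto intro!: power_mono)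
    then have xy: "norm x / norm y \<le> 1" using nz by simp
    have "1 / y - 1 / (y + 4) - 4 / ((y + 1) * (y + 3)) = 12 / (y * (y + 4) * (y + 1) * (y + 3))"
      using nz by (simp add: divide_simps) (simp add: algebra_simps)
    then have "norm (x * (1 / y - 1 / (y + 4) - 4 / ((y + 1) * (y + 3)))) =
        norm x / norm y * (12 / (norm (y + 4) * norm (y + 1) * norm (y + 3)))"
      by (simp add: norm_mult norm_divide)
    also have "\<dots> \<le> 1 * (12 / ((t + 4) * (t + 1) * (t + 3)))"
      using n nz t
      by (intro mult_mono xy divide_left_mono mult_pos_pos) auto
    also have "\<dots> \<le> 12 * (t + 2) / ((t\<^sup>2 + 6) * ((t + 4)\<^sup>2 + 6))"
    proof -
      have p: "t\<^sup>2 + 6 > 0" "(t + 4)\<^sup>2 + 6 > 0" by (auto intro: add_nonneg_pos)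
      \<comment> \<open>This polynomial is the difference of the two sides of the next inequality,
        arranged so that its sign for \<open>t\<close> at least 3 is visible.\<close>
      have "0 \<le> (t - 3) * (2 * t\<^sup>2 + 13 * t + 41) + 15"
        using t by (intro add_nonneg_nonneg mult_nonneg_nonneg) auto
      then have "((t\<^sup>2 + 6) * ((t + 4)\<^sup>2 + 6)) \<le> ((t + 4) * (t + 1) * (t + 3)) * (t + 2)"
        by (simp add: power2_eq_square algebra_simps)
      then have "12 * (t + 2) / (((t + 4) * (t + 1) * (t + 3)) * (t + 2)) \<le>
          12 * (t + 2) / ((t\<^sup>2 + 6) * ((t + 4)\<^sup>2 + 6))"
        using p t by (intro divide_left_mono mult_pos_pos) auto
      then show ?thesis using t by (subst (asm) nonzero_mult_divide_mult_cancel_right) simp_all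
    qed
    also have "\<dots> = (3 / 2) / (t\<^sup>2 + 6) - (3 / 2) / ((t + 4)\<^sup>2 + 6)"
    proof -
      have p: "t\<^sup>2 + 6 > 0" "(t + 4)\<^sup>2 + 6 > 0" by (auto intro: add_nonneg_pos)
      have "(3 / 2) / (t\<^sup>2 + 6) - (3 / 2) / ((t + 4)\<^sup>2 + 6) =
         ((3 / 2) * ((t + 4)\<^sup>2 + 6) - (3 / 2) * (t\<^sup>2 + 6)) / ((t\<^sup>2 + 6) * ((t + 4)\<^sup>2 + 6))"
        using p by (intro diff_frac_eq) auto
      also have "(3 / 2) * ((t + 4)\<^sup>2 + 6) - (3 / 2) * (t\<^sup>2 + 6) = 12 * (t + 2)"
        by (simp add: power2_eq_square algebra_simps)
      finally show ?thesis ..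
    qed
    finally show "norm (x * (1 / (x + of_nat (4 * k)) - 1 / (x + of_nat (4 * k) + 4) -
        4 / ((x + of_nat (4 * k) + 1) * (x + of_nat (4 * k) + 3)))) \<le> C k - C (Suc k)"
      by (simp add: C_def y_def t_def add_ac)
  qed (auto simp: C_def)
  moreover have "norm (x * (1 / x - nielsen_beta w)) = norm (x * nielsen_beta w - 1)"
    using x0 by (simp add: right_diff_distrib norm_minus_commute)
  ultimately show ?thesis by (simp add: C_def x_def)
qed

text \<open>Subtracting both telescoping series leaves terms of order \<open>1 / y^6\<close>. The
  constant is 100 from the leading remainder, 1 for the next one, and \<open>1 / 20\<close> because
  \<open>(s + 4)^5 - s^5\<close> is at least \<open>20 s^2 (s + 4)^2\<close>.\<close>

lemma nielsen_beta_second_order: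
  assumes "w \<notin> \<int>\<^sub>\<le>\<^sub>0" and x: "x = 2 * w - 1" and "t \<le> Re x" "14 \<le> t"
  shows "norm (1 / x - 1 / x ^ 3 - nielsen_beta w) \<le> (101 / 20) / t ^ 5"
proof -
  define C where "C k = (101 / 20) / (t + 4 * real k) ^ 5" for k
  have c3: "(\<lambda>k. 1 / (x + of_nat (4 * k)) ^ 3 - 1 / (x + of_nat (4 * k) + 4) ^ 3) sums (1 / x ^ 3)"
  proof -
    have "(\<lambda>k. inverse (x + of_nat (4 * k)) ^ 3) \<longlonglongrightarrow> 0 ^ 3"
      by (intro tendsto_power filterlim_compose[OF tendsto_inverse_0] tendsto_add_filterlim_at_infinity[OF tendsto_const]
           filterlim_compose[OF tendsto_of_nat] filterlim_subseq) (auto simp: strict_mono_def)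
    from telescope_sums'[OF this] show ?thesis
      by (simp add: inverse_eq_divide power_one_over add_ac)
  qed
  have "norm (1 / x - 1 / x ^ 3 - nielsen_beta w) \<le> C 0"
  proof (rule norm_sums_le_telescope[OF sums_diff[OF sums_diff[OF sums_inverse_arith_progression c3]
           nielsen_beta_sums_shifted[OF assms(1) x]]])
    fix k
    define y where "y = x + of_nat (4 * k)"
    define s where "s = t + 4 * real k"
    have s: "14 \<le> s" using assms by (simp add: s_def)
    have n: "s \<le> norm y" "s + 1 \<le> norm (y + 1)" "s + 3 \<le> norm (y + 3)" "s + 4 \<le> norm (y + 4)"
      using assms by (auto intro!: le_norm_if_le_Re simp: s_def y_def)
    have nz: "y \<noteq> 0" "y + 1 \<noteq> 0" "y + 3 \<noteq> 0" "y + 4 \<noteq> 0"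
      using n s by auto
    \<comment> \<open>By symmetry about \<open>y + 2\<close> the remainder is a rational function of
      \<open>p\<close> alone, as \<open>q = p + 3\<close>.\<close>
    define p q where "p = y * (y + 4)" and "q = (y + 1) * (y + 3)"
    have pq: "q = p + 3" by (simp add: p_def q_def algebra_simps)
    have pq0: "p \<noteq> 0" "q \<noteq> 0" using nz by (auto simp: p_def q_def)
    have ps: "s * (s + 4) \<le> norm p" and qs: "(s + 1) * (s + 3) \<le> norm q"
      using n s unfolding p_def q_def norm_mult by (intro mult_mono; simp)+
    have s4: "192 \<le> s * (s + 4)" using mult_mono[of 14 s 18 "s + 4"] s by simp
    have q1: "s * (s + 4) \<le> norm q" using qs by (simp add: algebra_simps)
    have "1 / y - 1 / (y + 4) = 4 / p" using nz by (simp add: p_def divide_simps)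
    moreover have "1 / y ^ 3 - 1 / (y + 4) ^ 3 = (12 * p + 64) / p ^ 3"
      using nz by (simp add: p_def divide_simps) (simp add: algebra_simps eval_nat_numeral)
    ultimately have "(1 / y - 1 / (y + 4)) - (1 / y ^ 3 - 1 / (y + 4) ^ 3) - 4 / ((y + 1) * (y + 3))
        = 4 / p - (12 * p + 64) / p ^ 3 - 4 / q"
      by (simp add: q_def)
    also have "\<dots> = - (100 / (p\<^sup>2 * q) + 192 / (p ^ 3 * q))"
      using pq0 by (simp add: divide_simps) (simp add: pq algebra_simps eval_nat_numeral)
    finally have "norm ((1 / y - 1 / (y + 4)) - (1 / y ^ 3 - 1 / (y + 4) ^ 3) - 4 / ((y + 1) * (y + 3)))
        = norm (100 / (p\<^sup>2 * q) + 192 / (p ^ 3 * q))" by (simp only: norm_minus_cancel)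
    also have "\<dots> \<le> 100 / (norm p ^ 2 * norm q) + 192 / (norm p ^ 3 * norm q)"
      by (rule order_trans[OF norm_triangle_ineq]) (simp add: norm_divide norm_mult norm_power)
    also have "192 / (norm p ^ 3 * norm q) = 192 / norm p * (1 / (norm p ^ 2 * norm q))"
      by (simp add: eval_nat_numeral)
    also have "\<dots> \<le> 1 * (1 / (norm p ^ 2 * norm q))"
      using ps s4 pq0 by (intro mult_right_mono) (auto simp: divide_le_eq)
    also have "100 / (norm p ^ 2 * norm q) + 1 * (1 / (norm p ^ 2 * norm q)) = 101 / (norm p ^ 2 * norm q)"
      by (simp add: divide_simps)
    also have "\<dots> \<le> 101 / ((s * (s + 4)) ^ 2 * (s * (s + 4)))"
      using ps q1 s pq0 by (intro divide_left_mono mult_mono power_mono mult_pos_pos) auto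
    also have "\<dots> = (101 / 20) * (20 * s\<^sup>2 * (s + 4)\<^sup>2) / (s ^ 5 * (s + 4) ^ 5)"
      using s by (simp add: divide_simps) (simp add: eval_nat_numeral)
    also have "\<dots> \<le> (101 / 20) * ((s + 4) ^ 5 - s ^ 5) / (s ^ 5 * (s + 4) ^ 5)"
    proof (intro divide_right_mono mult_left_mono)
      have "0 \<le> s ^ 3 * 160 + s\<^sup>2 * 320" using s by simp
      then show "20 * s\<^sup>2 * (s + 4)\<^sup>2 \<le> (s + 4) ^ 5 - s ^ 5"
        using s by (simp add: algebra_simps eval_nat_numeral)
    qed (use s in auto)
    also have "\<dots> = (101 / 20) / s ^ 5 - (101 / 20) / (s + 4) ^ 5"
      using s by (simp add: divide_simps)
    finally show "norm ((1 / (x + of_nat (4 * k)) - 1 / (x + of_nat (4 * k) + 4)) -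
        (1 / (x + of_nat (4 * k)) ^ 3 - 1 / (x + of_nat (4 * k) + 4) ^ 3) -
        4 / ((x + of_nat (4 * k) + 1) * (x + of_nat (4 * k) + 3))) \<le> C k - C (Suc k)"
      by (simp add: C_def y_def s_def add_ac)
  qed (use assms in \<open>auto simp: C_def\<close>)
  then show ?thesis by (simp add: C_def)
qed

section \<open>Numerical evaluation near the zero\<close>

text \<open>Reduces norm bounds for explicit complex numbers to rational comparisons, without square
  roots.\<close>

lemma norm_le_if_Re_Im_le:
  assumes "\<bar>Re u\<bar> \<le> a" "\<bar>Im u\<bar> \<le> a" "2 * a \<le> b"
  shows "norm u \<le> b"
  using assms cmod_le[of u] by linarith

text \<open>Moves the argument to the right, to where the asymptotic expansion is accurate.\<close>

lemma nielsen_beta_shift: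
  assumes "w \<notin> \<int>\<^sub>\<le>\<^sub>0"
  shows "nielsen_beta w = (\<Sum>k<n. 1 / ((w + of_nat (2 * k)) * (w + of_nat (2 * k) + 1))) +
           nielsen_beta (w + of_nat (2 * n))"
proof -
  have "nielsen_beta w = (\<Sum>k. 1 / ((w + of_nat (2 * (k + n))) * (w + of_nat (2 * (k + n)) + 1))) +
      (\<Sum>k<n. 1 / ((w + of_nat (2 * k)) * (w + of_nat (2 * k) + 1)))"
    unfolding nielsen_beta_def
    by (rule suminf_split_initial_segment[OF sums_summable[OF nielsen_beta_sums[OF assms]]])
  then show ?thesis
    by (simp add: nielsen_beta_def[of "w + 2 * of_nat n"] distrib_left add_ac)
qed

definition approx_zero :: complex where
  "approx_zero = Complex 1.3465165 1.05516006"

text \<open>Uses \<open>D_inf z = - nielsen_beta (- z)\<close> rather than the reflection formula,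
  so that neither \<open>pi\<close> nor a sine has to be evaluated. Sixteen terms are summed
  explicitly and the tail is expanded at \<open>w + 32\<close>; the four error bounds add up to
  \<open>1.32e-8\<close>.\<close>

lemma norm_D_inf_approx_zero: "norm (D_inf approx_zero) \<le> 0.000000015"
proof -
  define w where "w = Complex (-1.3465165) (-1.05516006)"
  \<comment> \<open>This is \<open>2 (w + 32) - 1\<close>, the expansion variable of the
    tail.\<close>
  define x where "x = Complex 60.306967 (-2.11032012)"
  define q where "q k = (w + of_nat (2 * k)) * (w + of_nat (2 * k) + 1)" for k
  \<comment> \<open>\<open>c ! k\<close> is \<open>1 / q k\<close> and \<open>t\<close> is \<open>1 / x - 1 / x\<^sup>3\<close>, rounded; multiplying by \<open>q k\<close> and \<open>x\<^sup>3\<close> makes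
      the verification division-free.\<close>
  define c where "c =
    [Complex (-0.1791805331864) (-0.4949063208361),
     Complex (-0.0055409690026) (0.4107345569800),
     Complex (0.0727690296574) (0.0564342495769),
     Complex (0.0334566016956) (0.0144416290513),
     Complex (0.0183876550858) (0.0055729450931),
     Complex (0.0115008608085) (0.0026953626910),
     Complex (0.0078407001298) (0.0014999561912),
     Complex (0.0056773154041) (0.0009180924199),
     Complex (0.0042965523447) (0.0006019247111),
     Complex (0.0033630083458) (0.0004156625756),
     Complex (0.0027029756979) (0.0002989232551),
     Complex (0.0022193934189) (0.0002220884520),
     Complex (0.0018546501711) (0.0001694727601),
     Complex (0.0015728279807) (0.0001322416540),
     Complex (0.0013506030359) (0.0001051609027),
     Complex (0.0011723015478) (0.0000849952063)]"
  define t where "t = Complex (0.016557026424) (0.000579061286)"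
  have w: "w \<notin> \<int>\<^sub>\<le>\<^sub>0" "w + of_nat (2 * 16) \<notin> \<int>\<^sub>\<le>\<^sub>0"
    by (auto elim!: nonpos_Ints_cases' simp: w_def complex_eq_iff)
  have wz: "w = - approx_zero"
    by (simp add: w_def approx_zero_def complex_eq_iff)
  have "approx_zero \<notin> \<nat>"
    by (auto elim!: Nats_cases simp: approx_zero_def complex_eq_iff)
  then have D: "D_inf approx_zero = - nielsen_beta w"
    by (simp add: D_inf_eq_nielsen_beta wz)
  have len: "length c = 16" by (simp add: c_def)
  have terms: "norm (1 / q k - c ! k) \<le> 0.0000000001" if "k < 16" for k
  proof -
    \<comment> \<open>Both factors of \<open>q k\<close> have imaginary part
      \<open>-1.05516006\<close>, so dividing the residual \<open>1 - c ! k * q k\<close> by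
      \<open>q k\<close> does not enlarge it.\<close>
    have "1 \<le> \<bar>Im u\<bar> \<Longrightarrow> 1 \<le> norm u" for u
      using abs_Im_le_cmod order_trans by blast
    then have "1 * 1 \<le> norm (q k)"
      unfolding q_def norm_mult by (intro mult_mono) (auto simp: w_def)
    then have q1: "1 \<le> norm (q k)" by simp
    have upt: "[0..<16] = [0, 1, 2, 3, 4, 5, 6, 7, 8, 9, 10, 11, 12, 13, 14, 15]"
      by (simp add: upt_rec)
    have "list_all (\<lambda>k. \<bar>Re (1 - c ! k * q k)\<bar> \<le> 0.00000000004 \<and>
        \<bar>Im (1 - c ! k * q k)\<bar> \<le> 0.00000000004) [0..<16]"
      unfolding upt by (simp add: c_def q_def w_def)
    with that have "\<bar>Re (1 - c ! k * q k)\<bar> \<le> 0.00000000004" "\<bar>Im (1 - c ! k * q k)\<bar> \<le> 0.00000000004"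
      by (auto simp: list_all_iff)
    then have le: "norm (1 - c ! k * q k) \<le> 0.0000000001"
      by (rule norm_le_if_Re_Im_le) simp
    have "1 / q k - c ! k = (1 - c ! k * q k) / q k"
      using q1 by (auto simp: divide_simps)
    then have "norm (1 / q k - c ! k) = norm (1 - c ! k * q k) / norm (q k)"
      by (simp add: norm_divide)
    also have "\<dots> \<le> 0.0000000001 / 1"
      using le q1 by (intro frac_le) auto
    finally show ?thesis by simp
  qed
  have "norm ((\<Sum>k<16. 1 / q k) - sum_list c) = norm (\<Sum>k<16. 1 / q k - c ! k)"
    by (simp add: sum_list_sum_nth len sum_subtractf atLeast0LessThan)
  also have "\<dots> \<le> (\<Sum>k<16::nat. 0.0000000001)"
    using terms by (intro sum_norm_le) auto
  finally have head: "norm ((\<Sum>k<16. 1 / q k) - sum_list c) \<le> 0.0000000016"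
    by simp
  have tail: "norm (1 / x - 1 / x ^ 3 - nielsen_beta (w + of_nat (2 * 16))) \<le> 0.0000000066"
  proof -
    have "norm (1 / x - 1 / x ^ 3 - nielsen_beta (w + of_nat (2 * 16))) \<le> (101 / 20) / 60 ^ 5"
      by (rule nielsen_beta_second_order[OF w(2)]) (simp_all add: x_def w_def complex_eq_iff)
    also have "\<dots> \<le> 0.0000000066" by simp
    finally show ?thesis .
  qed
  have asym: "norm (1 / x - 1 / x ^ 3 - t) \<le> 0.000000001"
  proof -
    have "60 \<le> norm x" by (rule le_norm_if_le_Re) (simp add: x_def)
    then have "60 ^ 3 \<le> norm x ^ 3" by (intro power_mono) auto
    then have x3: "216000 \<le> norm x ^ 3" by simp
    then have "x \<noteq> 0" by auto
    then have "1 / x - 1 / x ^ 3 - t = (x\<^sup>2 - 1 - t * x ^ 3) / x ^ 3"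
      by (simp add: field_simps eval_nat_numeral)
    then have "norm (1 / x - 1 / x ^ 3 - t) = norm (x\<^sup>2 - 1 - t * x ^ 3) / norm x ^ 3"
      by (simp add: norm_divide norm_power)
    also have "\<dots> \<le> 0.000001 / 216000"
    proof (intro frac_le)
      have "\<bar>Re (x\<^sup>2 - 1 - t * x ^ 3)\<bar> \<le> 0.0000002" "\<bar>Im (x\<^sup>2 - 1 - t * x ^ 3)\<bar> \<le> 0.0000002"
        by (simp_all add: x_def t_def power2_eq_square power3_eq_cube)
      then show "norm (x\<^sup>2 - 1 - t * x ^ 3) \<le> 0.000001"
        by (rule norm_le_if_Re_Im_le) simp
    qed (use x3 in auto)
    finally show ?thesis by simp
  qed
  \<comment> \<open>The rounded value of \<open>nielsen_beta w\<close>; the head and the tail cancel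
    because \<open>approx_zero\<close> lies close to a zero.\<close>
  have small: "norm (sum_list c + t) \<le> 0.000000004"
  proof -
    have "\<bar>Re (sum_list c + t)\<bar> \<le> 0.000000002" "\<bar>Im (sum_list c + t)\<bar> \<le> 0.000000002"
      by (simp_all add: c_def t_def)
    then show ?thesis by (rule norm_le_if_Re_Im_le) simp
  qed
  have "nielsen_beta w = ((\<Sum>k<16. 1 / q k) - sum_list c) + (sum_list c + t) + (1 / x - 1 / x ^ 3 - t)
      - (1 / x - 1 / x ^ 3 - nielsen_beta (w + of_nat (2 * 16)))"
    unfolding q_def by (subst nielsen_beta_shift[OF w(1), of 16]) (simp add: algebra_simps)
  also have "norm \<dots> \<le> 0.0000000016 + 0.000000004 + 0.000000001 + 0.0000000066"
    by (intro order_trans[OF norm_triangle_ineq4] order_trans[OF norm_triangle_ineq] add_mono head small asym tail)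
  finally show ?thesis by (simp add: D)
qed

section \<open>Confinement and separation of the zeros\<close>

text \<open>As the last summand lies between 0 and 1, this encloses the norm between
  \<open>sinh\<close> and \<open>cosh\<close> of the imaginary part.\<close>

lemma norm_sin_squared_sinh: "(norm (sin z))\<^sup>2 = (sinh (Im z))\<^sup>2 + (sin (Re z))\<^sup>2"
proof -
  have "(norm (sin z))\<^sup>2 = (sin (Re z) * cosh (Im z))\<^sup>2 + (cos (Re z) * sinh (Im z))\<^sup>2"
    by (simp add: cmod_power2 Re_sin Im_sin cosh_field_def sinh_field_def)
  also have "\<dots> = (sin (Re z))\<^sup>2 * ((sinh (Im z))\<^sup>2 + 1) + (1 - (sin (Re z))\<^sup>2) * (sinh (Im z))\<^sup>2"
    by (simp add: power_mult_distrib cosh_square_eq cos_squared_eq)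
  finally show ?thesis by (simp add: algebra_simps)
qed

lemma abs_sinh_Im_le_norm_sin: "\<bar>sinh (Im z)\<bar> \<le> norm (sin z)"
  by (rule power2_le_imp_le) (simp_all add: norm_sin_squared_sinh)

lemma norm_sin_le_cosh_Im: "norm (sin z) \<le> cosh (Im z)"
  by (rule power2_le_imp_le) (simp_all add: norm_sin_squared_sinh cosh_square_eq abs_square_le_1)

text \<open>A truncated Taylor series with nonnegative terms; \<open>t\<close> is factored out for
  comparison with linear functions of \<open>t\<close>.\<close>

lemma sinh_ge_polynomial:
  fixes t :: real
  assumes "0 \<le> t"
  shows "t * (1 + t\<^sup>2 / 6 + t ^ 4 / 120) \<le> sinh t"
proof -
  define f where "f n = (if even n then 0 else t ^ n /\<^sub>R fact n)" for n
  have f: "f sums sinh t" unfolding f_def by (rule sinh_converges)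
  have "sum f {..<6} \<le> suminf f"
    using assms by (intro sum_le_suminf sums_summable[OF f]) (auto simp: f_def)
  moreover have "sum f {..<6} = t * (1 + t\<^sup>2 / 6 + t ^ 4 / 120)"
  proof -
    have "{..<6::nat} = {0, 1, 2, 3, 4, 5}" by auto
    then have "sum f {..<6} = t + t ^ 3 / 6 + t ^ 5 / 120"
      by (simp add: f_def fact_numeral field_simps)
    also have "\<dots> = t * (1 + t\<^sup>2 / 6 + t ^ 4 / 120)"
      by (simp add: distrib_left eval_nat_numeral)
    finally show ?thesis .
  qed
  ultimately show ?thesis using f by (simp add: sums_iff)
qed

lemma norm_nielsen_beta_ge:
  assumes "2 \<le> Re w"
  shows "9 / 10 \<le> norm (2 * w - 1) * norm (nielsen_beta w)"
  using nielsen_beta_first_order[OF assms] norm_triangle_ineq3[of "1" "(2 * w - 1) * nielsen_beta w"]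
  by (simp add: norm_mult norm_minus_commute)

text \<open>At a zero of \<open>D\<^sub>\<infinity>\<close>, \<open>cosh (\<pi> Im z) \<ge> \<pi> / |\<beta>(z + 1)| \<ge> 3 \<pi>\<close>; this is where \<open>93 / 10\<close> comes from.\<close>

definition zero_region :: "complex set" where
  "zero_region = {z. 1 \<le> Re z \<and> Re z \<le> 3 / 2 \<and> 0 < Im z \<and> Im z \<le> 6 / 5 \<and> 93 / 10 \<le> sinh (pi * Im z)}"

lemma sin_pi_nonzero: "Im z \<noteq> 0 \<Longrightarrow> sin (of_real pi * z) \<noteq> 0"
  by (auto simp: sin_eq_0)

lemma notin_Ints_if_Im: "Im z \<noteq> 0 \<Longrightarrow> z \<notin> \<int>" "Im z \<noteq> 0 \<Longrightarrow> z \<notin> \<nat>"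
  by (auto elim!: Ints_cases Nats_cases)

text \<open>At a zero, \<open>sin (pi z) * nielsen_beta (z + 1) = - pi\<close>. The upper bound for
  the beta function forces the sine to be large, hence the imaginary part not too small. The lower
  bound lets the sine grow at most linearly, hence the imaginary part is not too large.\<close>

lemma zero_of_D_inf_in_zero_region:
  assumes z: "z \<in> upper_half_strip" and D: "D_inf z = 0"
  shows "z \<in> zero_region"
proof -
  define b where "b = nielsen_beta (z + 1)"
  define y where "y = Im z"
  have re: "1 < Re z" "Re z < 3 / 2" and y: "0 < y" using z by (auto simp: upper_half_strip_def y_def)
  have s: "sin (of_real pi * z) \<noteq> 0" using y by (intro sin_pi_nonzero) (simp add: y_def)
  have "of_real pi / sin (of_real pi * z) + b = 0"
    using D D_inf_reflection[of z] y by (simp add: b_def y_def notin_Ints_if_Im)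
  moreover have "sin (of_real pi * z) * b = sin (of_real pi * z) * (of_real pi / sin (of_real pi * z) + b) - of_real pi"
    using s by (simp add: distrib_left)
  ultimately have "sin (of_real pi * z) * b = - of_real pi"
    by simp
  then have "norm (sin (of_real pi * z) * b) = norm (- complex_of_real pi)"
    by (rule arg_cong)
  then have sb: "norm (sin (of_real pi * z)) * norm b = pi"
    by (simp add: norm_mult)
  have b1: "norm b \<le> 1 / 3"
    unfolding b_def using re by (intro norm_nielsen_beta_le) simp
  have b2: "9 / 10 \<le> norm (2 * z + 1) * norm b"
    using norm_nielsen_beta_ge[of "z + 1"] re by (simp add: b_def algebra_simps)
  have im: "Im (of_real pi * z) = pi * y" by (simp add: y_def)
  have "norm (sin (of_real pi * z)) * norm b \<le> cosh (pi * y) * (1 / 3)"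
    using norm_sin_le_cosh_Im[of "of_real pi * z", unfolded im] b1 by (intro mult_mono) auto
  then have "pi \<le> cosh (pi * y) * (1 / 3)" by (simp only: sb)
  \<comment> \<open>\<open>471 / 50\<close> is \<open>3 * 3.14\<close>; its square minus 1 still
    exceeds \<open>(93 / 10)^2\<close>.\<close>
  then have "471 / 50 \<le> cosh (pi * y)" using pi_approx by simp
  then have "471 / 50 * (471 / 50) \<le> cosh (pi * y) * cosh (pi * y)" by (intro mult_mono) auto
  moreover have "(sinh (pi * y))\<^sup>2 = cosh (pi * y) * cosh (pi * y) - 1"
    by (simp add: sinh_square_eq flip: power2_eq_square)
  ultimately have "8649 / 100 \<le> (sinh (pi * y))\<^sup>2" by simp
  moreover have "(93 / 10)\<^sup>2 = ((8649 / 100)::real)" by (simp add: power2_eq_square)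
  ultimately have "(93 / 10)\<^sup>2 \<le> (sinh (pi * y))\<^sup>2" by (simp only:)
  then have lower: "93 / 10 \<le> sinh (pi * y)" by (rule power2_le_imp_le) (use y in simp)
  have upper: "y \<le> 6 / 5"
  proof (rule ccontr)
    assume "\<not> y \<le> 6 / 5"
    then have y65: "6 / 5 < y" by simp
    \<comment> \<open>The squared norm is at most \<open>16 + 4 y^2\<close>, and
      \<open>16 \<le> (3.9^2 - 4) y^2\<close> once \<open>y\<close> exceeds
      \<open>6 / 5\<close>.\<close>
    have "norm (2 * z + 1) \<le> 39 / 10 * y"
    proof (rule power2_le_imp_le)
      have "(2 * Re z + 1) * (2 * Re z + 1) \<le> 4 * 4" using re by (intro mult_mono) auto
      moreover have "6 / 5 * (6 / 5) \<le> y * y" using y65 by (intro mult_mono) auto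
      ultimately have "(2 * Re z + 1) * (2 * Re z + 1) + (2 * y) * (2 * y) \<le> (39 / 10 * y) * (39 / 10 * y)" by simp
      then show "(norm (2 * z + 1))\<^sup>2 \<le> (39 / 10 * y)\<^sup>2"
        by (simp only: cmod_power2) (simp add: y_def power2_eq_square)
    qed (use y in simp)
    from order_trans[OF b2 mult_right_mono[OF this norm_ge_zero]]
    have "9 / 10 \<le> 39 / 10 * y * norm b" .
    then have "sinh (pi * y) * (9 / 10) \<le> norm (sin (of_real pi * z)) * (39 / 10 * y * norm b)"
      using abs_sinh_Im_le_norm_sin[of "of_real pi * z", unfolded im] y by (intro mult_mono) auto
    also have "\<dots> = 39 / 10 * (pi * y)" using sb by (simp add: mult_ac)
    finally have up: "sinh (pi * y) * (9 / 10) \<le> 39 / 10 * (pi * y)" .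
    define t where "t = pi * y"
    have "157 / 50 * (6 / 5) \<le> t" unfolding t_def using pi_approx y65 by (intro mult_mono) auto
    then have t: "94 / 25 \<le> t" by simp
    then have "94 / 25 * (94 / 25) \<le> t\<^sup>2" unfolding power2_eq_square by (intro mult_mono) auto
    then have t2: "14 \<le> t\<^sup>2" by simp
    then have "14 * 14 \<le> t\<^sup>2 * t\<^sup>2" by (intro mult_mono) auto
    \<comment> \<open>\<open>9 / 2\<close> exceeds \<open>(39 / 10) / (9 / 10) = 13 / 3\<close>, the
      slope permitted by \<open>up\<close>.\<close>
    with t2 have "9 / 2 \<le> 1 + t\<^sup>2 / 6 + t ^ 4 / 120" by (simp flip: power_add)
    then have "t * (9 / 2) \<le> t * (1 + t\<^sup>2 / 6 + t ^ 4 / 120)" using t by (intro mult_left_mono) auto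
    also have "\<dots> \<le> sinh t" using t by (intro sinh_ge_polynomial) auto
    finally show False using up t unfolding t_def[symmetric] by simp
  qed
  show ?thesis using re y lower upper by (simp add: zero_region_def y_def)
qed

section \<open>The auxiliary function \<open>Phi\<close> and the separation of its values\<close>

definition Phi :: "complex \<Rightarrow> complex" where
  "Phi z = sin (of_real pi * z) / of_real pi + 1 / nielsen_beta (z + 1)"

lemma nielsen_beta_plus1_nonzero:
  assumes "1 \<le> Re z"
  shows "nielsen_beta (z + 1) \<noteq> 0"
  using norm_nielsen_beta_ge[of "z + 1"] assms by auto

lemma Phi_eq_D_inf:
  assumes "1 \<le> Re z" "Im z \<noteq> 0"
  shows "Phi z = sin (of_real pi * z) * D_inf z / (of_real pi * nielsen_beta (z + 1))"
  using nielsen_beta_plus1_nonzero[OF assms(1)] sin_pi_nonzero[OF assms(2)]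
  by (simp add: Phi_def D_inf_reflection[OF notin_Ints_if_Im(1)[OF assms(2)]] divide_simps)

lemma Phi_eq_0_iff:
  assumes "1 \<le> Re z" "Im z \<noteq> 0"
  shows "Phi z = 0 \<longleftrightarrow> D_inf z = 0"
  using nielsen_beta_plus1_nonzero[OF assms(1)] sin_pi_nonzero[OF assms(2)]
  by (simp add: Phi_eq_D_inf[OF assms])

text \<open>On the region \<open>norm (2 * z + 1)\<close> is at most
  \<open>sqrt (4^2 + 2.4^2) < 4.67\<close>, and \<open>4.67 / 0.9 < 5.19\<close>.\<close>

lemma norm_inverse_nielsen_beta_le:
  assumes "z \<in> zero_region"
  shows "1 / norm (nielsen_beta (z + 1)) \<le> 519 / 100"
proof -
  have z: "1 \<le> Re z" "Re z \<le> 3 / 2" "0 < Im z" "Im z \<le> 6 / 5"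
    using assms by (auto simp: zero_region_def)
  have "norm (2 * z + 1) \<le> 467 / 100"
  proof (rule power2_le_imp_le)
    have "(2 * Re z + 1)\<^sup>2 \<le> 4\<^sup>2" "(2 * Im z)\<^sup>2 \<le> (12 / 5)\<^sup>2" using z by (intro power_mono; simp)+
    then show "(norm (2 * z + 1))\<^sup>2 \<le> (467 / 100)\<^sup>2"
      by (simp add: cmod_power2) (simp add: power2_eq_square)
  qed simp
  then have "norm (2 * z + 1) * norm (nielsen_beta (z + 1)) \<le> 467 / 100 * norm (nielsen_beta (z + 1))"
    by (intro mult_right_mono) auto
  then have "9 / 10 \<le> 467 / 100 * norm (nielsen_beta (z + 1))"
    using norm_nielsen_beta_ge[of "z + 1"] z by (simp add: algebra_simps)
  then show ?thesis using nielsen_beta_plus1_nonzero[OF z(1)] by (simp add: divide_le_eq)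
qed

text \<open>The mean value theorem on a segment yields an intermediate point only for a real part,
  so the sine is first multiplied by a constant \<open>l\<close> that makes the real part of the
  derivative large all along the segment.\<close>

lemma norm_sin_pi_diff_ge:
  assumes z: "z\<^sub>1 \<in> zero_region" "z\<^sub>2 \<in> zero_region"
  shows "657 / 100 * norm (z\<^sub>1 - z\<^sub>2) \<le> norm (sin (of_real pi * z\<^sub>1) - sin (of_real pi * z\<^sub>2)) / pi"
proof (cases "z\<^sub>1 = z\<^sub>2")
  case False
  define d where "d = z\<^sub>1 - z\<^sub>2"
  have d: "d \<noteq> 0" using False by (simp add: d_def)
  \<comment> \<open>\<open>Re (l * u) = \<bar>Re u\<bar> + \<bar>Im u\<bar> \<ge> norm u\<close> for \<open>u\<close> in the second quadrant.\<close>
  define l where "l = Complex (-1) (-1)"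
  define f where "f u = l * sin (of_real pi * u) / (of_real pi * d)" for u
  have "(f has_field_derivative (l * cos (of_real pi * u) / d)) (at u)" for u
    unfolding f_def using d by (auto intro!: derivative_eq_intros simp: divide_simps)
  then obtain u where u: "u \<in> closed_segment z\<^sub>2 z\<^sub>1"
    and mvt: "Re (f z\<^sub>1) - Re (f z\<^sub>2) = Re (l * cos (of_real pi * u) / d * (z\<^sub>1 - z\<^sub>2))"
    using complex_mvt_line[of z\<^sub>2 z\<^sub>1 f "\<lambda>u. l * cos (of_real pi * u) / d"] by blast
  have "closed_segment z\<^sub>2 z\<^sub>1 \<subseteq> {z. 1 \<le> Re z}" "closed_segment z\<^sub>2 z\<^sub>1 \<subseteq> {z. Re z \<le> 3 / 2}"
    "closed_segment z\<^sub>2 z\<^sub>1 \<subseteq> {z. min (Im z\<^sub>1) (Im z\<^sub>2) \<le> Im z}"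
    using z by (intro closed_segment_subset convex_halfspace_Re_ge convex_halfspace_Re_le
      convex_halfspace_Im_ge; simp add: zero_region_def)+
  with u have re: "1 \<le> Re u" "Re u \<le> 3 / 2" and im: "min (Im z\<^sub>1) (Im z\<^sub>2) \<le> Im u" by auto
  \<comment> \<open>Both are nonnegative because \<open>pi * Re u\<close> lies in the third
    quadrant. Then \<open>cos (pi u)\<close> has real part \<open>- p cosh (pi Im u)\<close> and
    imaginary part \<open>r sinh (pi Im u)\<close>.\<close>
  define p r where "p = - cos (pi * Re u)" and "r = - sin (pi * Re u)"
  have pr: "0 \<le> p" "0 \<le> r"
  proof -
    have "pi * Re u - pi \<le> pi / 2" "0 \<le> pi * Re u - pi"
      using re by (auto simp: field_simps)
    then have "0 \<le> cos (pi * Re u - pi)" "0 \<le> sin (pi * Re u - pi)"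
      using pi_gt_zero by (intro cos_ge_zero sin_ge_zero; linarith)+
    then show "0 \<le> p" "0 \<le> r" by (simp_all add: p_def r_def)
  qed
  have "p\<^sup>2 + r\<^sup>2 = 1" by (simp add: p_def r_def)
  then have "1\<^sup>2 \<le> (p + r)\<^sup>2" using pr by (simp add: power2_sum)
  then have pr1: "1 \<le> p + r" by (rule power2_le_imp_le) (use pr in simp)
  have sinh: "93 / 10 \<le> sinh (pi * Im u)"
  proof -
    have "93 / 10 \<le> sinh (pi * min (Im z\<^sub>1) (Im z\<^sub>2))"
      using z by (auto simp: zero_region_def min_def)
    also have "\<dots> \<le> sinh (pi * Im u)" using im by simp
    finally show ?thesis .
  qed
  have "93 / 10 \<le> (p + r) * sinh (pi * Im u)"
    using mult_mono[OF pr1 sinh] pr by simp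
  also have "\<dots> \<le> p * cosh (pi * Im u) + r * sinh (pi * Im u)"
    using pr mult_left_mono[OF sinh_le_cosh_real[of "pi * Im u"], of p] by (simp add: algebra_simps)
  also have "\<dots> = Re (l * cos (of_real pi * u))"
    by (simp add: l_def p_def r_def Re_cos Im_cos cosh_field_def sinh_field_def field_simps)
  also have "\<dots> = Re (f z\<^sub>1 - f z\<^sub>2)"
    using mvt d by (simp add: d_def)
  also have "\<dots> \<le> norm (f z\<^sub>1 - f z\<^sub>2)" by (rule complex_Re_le_cmod)
  also have "f z\<^sub>1 - f z\<^sub>2 = l * (sin (of_real pi * z\<^sub>1) - sin (of_real pi * z\<^sub>2)) / (of_real pi * d)"
    by (simp add: f_def diff_divide_distrib right_diff_distrib)
  also have "norm \<dots> = norm l * (norm (sin (of_real pi * z\<^sub>1) - sin (of_real pi * z\<^sub>2)) / pi) / norm d"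
    by (simp add: norm_mult norm_divide)
  \<comment> \<open>\<open>283 / 200\<close> is slightly above \<open>sqrt 2\<close>, and
    \<open>9.3 / 1.415 > 6.57\<close>.\<close>
  also have "\<dots> \<le> 283 / 200 * (norm (sin (of_real pi * z\<^sub>1) - sin (of_real pi * z\<^sub>2)) / pi) / norm d"
  proof (intro divide_right_mono mult_right_mono)
    show "norm l \<le> 283 / 200"
    proof (rule power2_le_imp_le)
      have "(norm l)\<^sup>2 = 2" by (simp add: cmod_power2 l_def)
      then show "(norm l)\<^sup>2 \<le> (283 / 200)\<^sup>2" by (simp add: power_divide)
    qed simp
  qed auto
  finally have "93 / 10 * norm d \<le> 283 / 200 * (norm (sin (of_real pi * z\<^sub>1) - sin (of_real pi * z\<^sub>2)) / pi)"
    by (rule pos_le_divide_eq[THEN iffD1, rotated]) (use d in simp)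
  then show ?thesis unfolding d_def using norm_ge_zero[of "z\<^sub>1 - z\<^sub>2"] by linarith
qed auto

text \<open>The sine part expands distances by at least \<open>6.57\<close>, while
  \<open>1 / nielsen_beta (z + 1)\<close> has Lipschitz constant at most
  \<open>5.19^2 / 5 < 5.4\<close>; the difference exceeds \<open>23 / 20\<close>.\<close>

lemma norm_Phi_diff_ge:
  assumes z: "z\<^sub>1 \<in> zero_region" "z\<^sub>2 \<in> zero_region"
  shows "23 / 20 * norm (z\<^sub>1 - z\<^sub>2) \<le> norm (Phi z\<^sub>1 - Phi z\<^sub>2)"
proof -
  define b where "b z = nielsen_beta (z + 1)" for z
  have re: "1 \<le> Re z\<^sub>1" "1 \<le> Re z\<^sub>2" using z by (auto simp: zero_region_def)
  have nz: "b z\<^sub>1 \<noteq> 0" "b z\<^sub>2 \<noteq> 0" using re by (auto simp: b_def nielsen_beta_plus1_nonzero)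
  have "norm (1 / b z\<^sub>1 - 1 / b z\<^sub>2) = norm (b z\<^sub>2 - b z\<^sub>1) * (1 / norm (b z\<^sub>1)) * (1 / norm (b z\<^sub>2))"
    using nz by (simp add: norm_mult norm_divide diff_frac_eq)
  also have "\<dots> \<le> norm (z\<^sub>1 - z\<^sub>2) / 5 * (519 / 100) * (519 / 100)"
  proof (intro mult_mono)
    show "norm (b z\<^sub>2 - b z\<^sub>1) \<le> norm (z\<^sub>1 - z\<^sub>2) / 5"
      using norm_nielsen_beta_diff_le[of "z\<^sub>2 + 1" "z\<^sub>1 + 1"] re
      by (simp add: b_def norm_minus_commute)
    show "1 / norm (b z\<^sub>1) \<le> 519 / 100"
      unfolding b_def by (rule norm_inverse_nielsen_beta_le[OF z(1)])
    show "1 / norm (b z\<^sub>2) \<le> 519 / 100"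
      unfolding b_def by (rule norm_inverse_nielsen_beta_le[OF z(2)])
  qed auto
  also have "\<dots> \<le> 27 / 5 * norm (z\<^sub>1 - z\<^sub>2)" by simp
  finally have "norm (1 / b z\<^sub>1 - 1 / b z\<^sub>2) \<le> 27 / 5 * norm (z\<^sub>1 - z\<^sub>2)" .
  moreover have "norm (sin (of_real pi * z\<^sub>1) - sin (of_real pi * z\<^sub>2)) / pi \<le>
      norm (Phi z\<^sub>1 - Phi z\<^sub>2) + norm (1 / b z\<^sub>1 - 1 / b z\<^sub>2)"
  proof -
    have "(sin (of_real pi * z\<^sub>1) - sin (of_real pi * z\<^sub>2)) / of_real pi =
        (Phi z\<^sub>1 - Phi z\<^sub>2) - (1 / b z\<^sub>1 - 1 / b z\<^sub>2)"
      by (simp add: Phi_def b_def diff_divide_distrib)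
    then have "norm ((sin (of_real pi * z\<^sub>1) - sin (of_real pi * z\<^sub>2)) / of_real pi) \<le>
        norm (Phi z\<^sub>1 - Phi z\<^sub>2) + norm (1 / b z\<^sub>1 - 1 / b z\<^sub>2)"
      using norm_triangle_ineq4 by metis
    then show ?thesis by (simp add: norm_divide)
  qed
  ultimately show ?thesis
    using norm_sin_pi_diff_ge[OF z] norm_ge_zero[of "z\<^sub>1 - z\<^sub>2"] by linarith
qed

section \<open>Existence and multiplicity\<close>

lemma D_inf_holomorphic: "D_inf holomorphic_on {z. Im z \<noteq> 0}"
proof -
  have "nielsen_beta holomorphic_on uminus ` {z. Im z \<noteq> 0}"
    using notin_Ints_if_Im(1) nonpos_Ints_subset_Ints
    by (intro analytic_imp_holomorphic analytic_on_nielsen_beta) (auto dest!: nonpos_Ints_Int)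
  then have "(\<lambda>z. - nielsen_beta (- z)) holomorphic_on {z. Im z \<noteq> 0}"
    by (intro holomorphic_intros holomorphic_on_compose_gen[of uminus _ nielsen_beta, unfolded o_def]) auto
  then show ?thesis
    by (subst holomorphic_cong[OF refl D_inf_eq_nielsen_beta]) (auto dest: notin_Ints_if_Im(2))
qed

lemma D_inf_analytic:
  assumes "Im z \<noteq> 0"
  shows "D_inf analytic_on {z}"
proof -
  have "open {z. Im z \<noteq> 0}" by (intro open_Collect_neq continuous_intros)
  then show ?thesis
    using D_inf_holomorphic assms by (auto simp: analytic_at)
qed

text \<open>The lower bound on the difference quotients passes to the limit, so the derivative at
  the zero does not vanish.\<close>

lemma zorder_eq_1_if_linear_lower_bound:
  fixes f :: "complex \<Rightarrow> complex"
  assumes "f analytic_on {z}" "f z = 0" "0 < c" "0 < e"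
    and le: "\<And>w. dist w z < e \<Longrightarrow> c * dist w z \<le> norm (f w)"
  shows "zorder f z = 1"
proof -
  have "f field_differentiable at z"
    using assms(1) analytic_on_imp_differentiable_at by blast
  then have "(f has_field_derivative deriv f z) (at z)"
    by (rule field_differentiable_derivI)
  then have "((\<lambda>w. (f w - f z) / (w - z)) \<longlongrightarrow> deriv f z) (at z)"
    by (simp only: has_field_derivative_iff)
  then have "((\<lambda>w. norm ((f w - f z) / (w - z))) \<longlongrightarrow> norm (deriv f z)) (at z)"
    by (rule tendsto_norm)
  moreover have "\<forall>\<^sub>F w in at z. c \<le> norm ((f w - f z) / (w - z))"
    unfolding eventually_at
  proof (intro exI conjI ballI impI)
    fix w assume "w \<noteq> z \<and> dist w z < e"
    then show "c \<le> norm ((f w - f z) / (w - z))"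
      using le[of w] assms(2) by (simp add: norm_divide dist_norm le_divide_eq)
  qed fact
  ultimately have "c \<le> norm (deriv f z)"
    by (rule tendsto_lowerbound) simp
  then have "deriv f z \<noteq> 0" using assms(3) by auto
  then show ?thesis using assms(1,2) by (intro zorder_zero_eqI') auto
qed

text \<open>The radius is just below \<open>1.5e-6\<close>, the distance from
  \<open>Re approx_zero\<close> to the lower end \<open>1.346515 = 1.34652 - 0.000005\<close> of the
  claimed interval.\<close>

lemma Re_Im_near_approx_zero:
  assumes "norm (approx_zero - z) \<le> 0.00000145"
  shows "1.346515 \<le> Re z" "Re z \<le> 1.346518" "1.055158 \<le> Im z" "Im z \<le> 1.055162"
proof -
  have "Re approx_zero - Re z \<le> norm (approx_zero - z)" "Re z - Re approx_zero \<le> norm (approx_zero - z)"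
    "Im approx_zero - Im z \<le> norm (approx_zero - z)" "Im z - Im approx_zero \<le> norm (approx_zero - z)"
    using abs_Re_le_cmod[of "approx_zero - z"] abs_Im_le_cmod[of "approx_zero - z"] by simp_all
  with assms show "1.346515 \<le> Re z" "Re z \<le> 1.346518" "1.055158 \<le> Im z" "Im z \<le> 1.055162"
    by (simp_all add: approx_zero_def)
qed

lemma cball_approx_zero_subset: "cball approx_zero 0.00000145 \<subseteq> zero_region"
proof
  fix z assume "z \<in> cball approx_zero 0.00000145"
  then have b: "134 / 100 \<le> Re z" "Re z \<le> 135 / 100" "105 / 100 \<le> Im z" "Im z \<le> 106 / 100"
    using Re_Im_near_approx_zero[of z] by (simp_all add: dist_norm)
  define t where "t = pi * Im z"
  have "157 / 50 * (21 / 20) \<le> t" unfolding t_def using pi_approx b by (intro mult_mono) auto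
  then have t: "329 / 100 \<le> t" by simp
  then have "329 / 100 * (329 / 100) \<le> t\<^sup>2" unfolding power2_eq_square by (intro mult_mono) auto
  then have t2: "10 \<le> t\<^sup>2" by simp
  then have "10 * 10 \<le> t\<^sup>2 * t\<^sup>2" by (intro mult_mono) auto
  with t2 have "3 \<le> 1 + t\<^sup>2 / 6 + t ^ 4 / 120" by (simp flip: power_add)
  then have "329 / 100 * 3 \<le> t * (1 + t\<^sup>2 / 6 + t ^ 4 / 120)" using t by (intro mult_mono) auto
  also have "\<dots> \<le> sinh t" using t by (intro sinh_ge_polynomial) auto
  finally show "z \<in> zero_region" using b by (simp add: zero_region_def t_def)
qed

text \<open>Transfers the numerical bound from \<open>D_inf\<close> to \<open>Phi\<close>; the
  factor between them is at most \<open>23 * 5.19 / 3\<close>.\<close>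

lemma norm_Phi_approx_zero: "norm (Phi approx_zero) \<le> 0.0000008"
proof -
  have z: "approx_zero \<in> zero_region" using cball_approx_zero_subset by auto
  define t where "t = pi * Im approx_zero"
  have "t \<le> 3.1416 * 1.0552"
    unfolding t_def using pi_approx by (intro mult_mono) (auto simp: approx_zero_def)
  then have t: "0 \<le> t" "t \<le> 17 / 5" by (auto simp: t_def approx_zero_def)
  \<comment> \<open>Split so that \<open>exp 1 \<le> 3\<close> and the quadratic bound for
    \<open>exp\<close> on the unit interval apply.\<close>
  have "exp ((17 / 5)::real) = exp 1 * exp 1 * exp 1 * exp (2 / 5)"
    by (simp flip: exp_add)
  also have "\<dots> \<le> 3 * 3 * 3 * (1 + (2 / 5) + (2 / 5)\<^sup>2)"
    using exp_le by (intro mult_mono exp_bound) auto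
  finally have "exp ((17 / 5)::real) \<le> 45" by (simp add: power2_eq_square)
  moreover have "exp t \<le> exp (17 / 5)" using t by simp
  ultimately have "exp t \<le> 45" by (rule order_trans[rotated])
  moreover have "exp (- t) \<le> 1" using t by simp
  ultimately have "exp t + exp (- t) \<le> 45 + 1" by (rule add_mono)
  then have "cosh t \<le> 23" by (simp add: cosh_field_def)
  then have s: "norm (sin (of_real pi * approx_zero)) \<le> 23"
    using norm_sin_le_cosh_Im[of "of_real pi * approx_zero"] by (simp add: t_def)
  have "norm (Phi approx_zero) = norm (sin (of_real pi * approx_zero)) * norm (D_inf approx_zero) *
      (1 / norm (nielsen_beta (approx_zero + 1))) / pi"
    by (subst Phi_eq_D_inf) (simp_all add: approx_zero_def norm_mult norm_divide)
  also have "\<dots> \<le> 23 * 0.000000015 * (519 / 100) / 3"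
  proof (rule frac_le)
    show "norm (sin (of_real pi * approx_zero)) * norm (D_inf approx_zero) *
      (1 / norm (nielsen_beta (approx_zero + 1))) \<le> 23 * 0.000000015 * (519 / 100)"
      by (intro mult_mono s norm_D_inf_approx_zero norm_inverse_nielsen_beta_le[OF z]) auto
  qed (use pi_gt3 in auto)
  also have "\<dots> \<le> 0.0000008" by simp
  finally show ?thesis .
qed

lemma Phi_holomorphic: "Phi holomorphic_on {z. 1 \<le> Re z}"
proof -
  have "z + 1 \<notin> \<int>\<^sub>\<le>\<^sub>0" if "1 \<le> Re z" for z
    using that by (intro notin_nonpos_Ints_if_Re_pos) simp
  then have "nielsen_beta holomorphic_on (\<lambda>z. z + 1) ` {z. 1 \<le> Re z}"
    by (intro analytic_imp_holomorphic analytic_on_nielsen_beta) blast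
  then have "(\<lambda>z. nielsen_beta (z + 1)) holomorphic_on {z. 1 \<le> Re z}"
    by (intro holomorphic_on_compose_gen[of "\<lambda>z. z + 1" _ nielsen_beta, unfolded o_def] holomorphic_intros) auto
  then show ?thesis unfolding Phi_def
    by (intro holomorphic_intros) (auto simp: nielsen_beta_plus1_nonzero)
qed

text \<open>On the bounding circle \<open>Phi\<close> is larger than at the centre:
  \<open>1.15 * 1.45e-6\<close> exceeds \<open>2 * 8e-7\<close>. A holomorphic function with this
  property has a zero inside.\<close>

lemma ex_zero_near_approx_zero: "\<exists>\<rho>\<in>ball approx_zero 0.00000145. D_inf \<rho> = 0"
proof -
  let ?r = "0.00000145 :: real"
  have sub: "cball approx_zero ?r \<subseteq> {z. 1 \<le> Re z}"
    using cball_approx_zero_subset by (auto simp: zero_region_def)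
  have hol: "Phi holomorphic_on cball approx_zero ?r"
    using Phi_holomorphic sub by (rule holomorphic_on_subset)
  obtain \<rho> where \<rho>: "\<rho> \<in> ball approx_zero ?r" "Phi \<rho> = 0"
  proof (rule holomorphic_contract_to_zero[of approx_zero ?r Phi])
    show "continuous_on (cball approx_zero ?r) Phi"
      using hol by (rule holomorphic_on_imp_continuous_on)
    show "Phi holomorphic_on ball approx_zero ?r"
      using hol by (rule holomorphic_on_subset) auto
    fix z assume z: "norm (approx_zero - z) = ?r"
    then have "z \<in> zero_region" "approx_zero \<in> zero_region"
      using cball_approx_zero_subset by (auto simp: dist_norm)
    then have "23 / 20 * ?r \<le> norm (Phi approx_zero - Phi z)"
      using norm_Phi_diff_ge[of approx_zero z] z by simp
    also have "\<dots> \<le> norm (Phi approx_zero) + norm (Phi z)" by (rule norm_triangle_ineq4)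
    finally show "norm (Phi approx_zero) < norm (Phi z)"
      using norm_Phi_approx_zero by simp
  qed auto
  then have "\<rho> \<in> zero_region" using cball_approx_zero_subset by auto
  then have "D_inf \<rho> = 0" using Phi_eq_0_iff[of \<rho>] \<rho>(2) by (auto simp: zero_region_def)
  with \<rho> show ?thesis by blast
qed

text \<open>Carries the separation bound from \<open>Phi\<close> back to \<open>D_inf\<close>; both
  uniqueness and simplicity follow from it. Only the positivity of the constant matters, so
  \<open>cosh 5\<close> is a crude bound for the sine, from \<open>pi * 6 / 5 < 5\<close>.\<close>

lemma norm_D_inf_ge:
  assumes "z \<in> zero_region" "\<rho> \<in> zero_region" "D_inf \<rho> = 0"
  shows "(23 / 20) / ((519 / 100) * cosh 5) * dist z \<rho> \<le> norm (D_inf z)"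
proof -
  have z: "1 \<le> Re z" "0 < Im z" "Im z \<le> 6 / 5" using assms by (auto simp: zero_region_def)
  have "Phi \<rho> = 0" using assms(2,3) Phi_eq_0_iff[of \<rho>] by (auto simp: zero_region_def)
  then have "23 / 20 * dist z \<rho> \<le> norm (Phi z)"
    using norm_Phi_diff_ge[OF assms(1,2)] by (simp add: dist_norm)
  also have "\<dots> = norm (sin (of_real pi * z)) * norm (D_inf z) * (1 / norm (nielsen_beta (z + 1))) / pi"
    using z by (subst Phi_eq_D_inf) (simp_all add: norm_mult norm_divide)
  also have "\<dots> \<le> cosh 5 * norm (D_inf z) * (519 / 100) / 1"
  proof (rule frac_le)
    have "pi * Im z \<le> 4 * (6 / 5)" using z pi_less_4 by (intro mult_mono) auto
    then have "cosh (pi * Im z) \<le> cosh 5"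
      using z by (subst cosh_real_nonneg_le_iff) auto
    then have "norm (sin (of_real pi * z)) \<le> cosh 5"
      using norm_sin_le_cosh_Im[of "of_real pi * z"] by simp
    then show "norm (sin (of_real pi * z)) * norm (D_inf z) * (1 / norm (nielsen_beta (z + 1)))
        \<le> cosh 5 * norm (D_inf z) * (519 / 100)"
      by (intro mult_mono norm_inverse_nielsen_beta_le assms) auto
  qed (use pi_gt3 in auto)
  finally show ?thesis by (simp add: field_simps)
qed

theorem theorem3p4:
  shows "(\<forall>z. z \<notin> \<nat> \<longrightarrow> D_inf (cnj z) = cnj (D_inf z)) \<and>
    (\<exists>\<rho>\<^sub>1.
      {z \<in> upper_half_strip. D_inf z = 0} = {\<rho>\<^sub>1} \<and> zorder D_inf \<rho>\<^sub>1 = 1 \<and>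
      {z \<in> lower_half_strip. D_inf z = 0} = {cnj \<rho>\<^sub>1} \<and> zorder D_inf (cnj \<rho>\<^sub>1) = 1 \<and>
      \<bar>Re \<rho>\<^sub>1 - 1.34652\<bar> \<le> 0.000005 \<and> \<bar>Im \<rho>\<^sub>1 - 1.05516\<bar> \<le> 0.000005)"
proof -
  obtain \<rho> where \<rho>: "\<rho> \<in> ball approx_zero 0.00000145" "D_inf \<rho> = 0"
    using ex_zero_near_approx_zero by blast
  have \<rho>R: "\<rho> \<in> zero_region" using \<rho>(1) cball_approx_zero_subset by auto
  have "norm (approx_zero - \<rho>) \<le> 0.00000145" using \<rho>(1) by (simp add: dist_norm)
  note near = Re_Im_near_approx_zero[OF this]
  have close: "\<bar>Re \<rho> - 1.34652\<bar> \<le> 0.000005" "\<bar>Im \<rho> - 1.05516\<bar> \<le> 0.000005"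
    unfolding abs_le_iff using near by simp_all
  have \<rho>S: "\<rho> \<in> upper_half_strip"
    using near by (simp add: upper_half_strip_def)
  have upper: "{z \<in> upper_half_strip. D_inf z = 0} = {\<rho>}"
  proof -
    have "z = \<rho>" if "z \<in> upper_half_strip" "D_inf z = 0" for z
    proof -
      have "0 < (23 / 20) / ((519 / 100) * cosh (5::real))" by (intro divide_pos_pos mult_pos_pos) auto
      moreover have "(23 / 20) / ((519 / 100) * cosh 5) * dist z \<rho> \<le> 0"
        using norm_D_inf_ge[OF zero_of_D_inf_in_zero_region[OF that] \<rho>R \<rho>(2)] that(2) by simp
      ultimately have "dist z \<rho> \<le> 0"
        by (metis mult_le_0_iff not_le)
      then show ?thesis by simp
    qed
    then show ?thesis using \<rho>S \<rho>(2) by blast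
  qed
  have cnj_zero: "D_inf (cnj z) = cnj (D_inf z)" if "Im z \<noteq> 0" for z
    using that by (intro D_inf_cnj notin_Ints_if_Im(2))
  have lower: "{z \<in> lower_half_strip. D_inf z = 0} = {cnj \<rho>}"
  proof -
    have "z = cnj \<rho>" if "z \<in> lower_half_strip" "D_inf z = 0" for z
    proof -
      have "cnj z \<in> {z \<in> upper_half_strip. D_inf z = 0}"
        using that by (auto simp: lower_half_strip_def upper_half_strip_def cnj_zero)
      then show ?thesis unfolding upper by (metis complex_cnj_cnj singletonD)
    qed
    moreover have "cnj \<rho> \<in> lower_half_strip" "D_inf (cnj \<rho>) = 0"
      using \<rho>S \<rho>(2) by (auto simp: lower_half_strip_def upper_half_strip_def cnj_zero)
    ultimately show ?thesis by blast
  qed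
  have Im: "Im \<rho> \<noteq> 0" using \<rho>S by (simp add: upper_half_strip_def)
  define c :: real where "c = (23 / 20) / ((519 / 100) * cosh 5)"
  have c: "0 < c" unfolding c_def by (intro divide_pos_pos mult_pos_pos) auto
  obtain e where e: "0 < e" "ball \<rho> e \<subseteq> zero_region"
  proof -
    obtain e where "0 < e" "ball \<rho> e \<subseteq> ball approx_zero 0.00000145"
      using \<rho>(1) open_ball openE by blast
    then show ?thesis using that cball_approx_zero_subset by (meson ball_subset_cball order_trans)
  qed
  have le: "c * dist z \<rho> \<le> norm (D_inf z)" if "dist z \<rho> < e" for z
    unfolding c_def using that e(2) by (intro norm_D_inf_ge \<rho>R \<rho>(2)) (auto simp: dist_commute)
  have "zorder D_inf \<rho> = 1"
    by (rule zorder_eq_1_if_linear_lower_bound[OF D_inf_analytic[OF Im] \<rho>(2) c e(1) le])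
  \<comment> \<open>The linear lower bound near \<open>cnj \<rho>\<close> is the one near
    \<open>\<rho>\<close> carried over by conjugation, which preserves distances and norms.\<close>
  moreover have "zorder D_inf (cnj \<rho>) = 1"
  proof (rule zorder_eq_1_if_linear_lower_bound[OF D_inf_analytic _ c e(1)])
    show "D_inf (cnj \<rho>) = 0" using Im \<rho>(2) by (simp add: cnj_zero)
    fix z assume "dist z (cnj \<rho>) < e"
    then have d: "dist (cnj z) \<rho> < e" "dist (cnj z) \<rho> = dist z (cnj \<rho>)"
      by (simp_all add: dist_norm) (metis complex_cnj_cnj complex_cnj_diff complex_mod_cnj)+
    then have "cnj z \<in> ball \<rho> e" by (simp add: dist_commute)
    then have "cnj z \<in> zero_region" using e(2) by blast
    then have "Im z \<noteq> 0" by (auto simp: zero_region_def)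
    then have "norm (D_inf (cnj z)) = norm (D_inf z)" using cnj_zero[of z] by simp
    then show "c * dist z (cnj \<rho>) \<le> norm (D_inf z)"
      using le[OF d(1)] d(2) by simp
  qed (use Im in auto)
  ultimately show ?thesis
    using D_inf_cnj upper lower close by blast
qed

end
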